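(* Assume the stability condition, condition (C), $\rho_1\neq\rho_2$, Assumption (E), and the span condition (S) of the context. Then there exist constants $c_9,c_{10},c_{11}$ such that, with $$h^{a,0}\doteq c_{11}\left(\mathfrak h_{\rho_2}+c_{10}h_{\rho_1}\right),$$ one has $$\mathbb P_{(y,m)}(\tau<\infty)<h^{a,0}(y,m)<c_9\,\mathbb P_{(y,m)}(\tau<\infty)\qquad\text{for all }(y,m)\in B\times\mathcal M.$$
   Context: Setting: $\mathcal M$ is a finite set, $\bm P$ an irreducible aperiodic transition matrix on $\mathcal M$ with stationary distribution $\bm\pi$; for each $m\in\mathcal M$, $\lambda(m),\mu_1(m),\mu_2(m)>0$ and $\lambda(m)+\mu_1(m)+\mu_2(m)=1$. $(Y,M)$ is the Markov chain on $\mathbb Z\times\mathbb Z_+\times\mathcal M$ which from $(y,m)$ moves to $(y,m')$ with probability $\bm P(m,m')$ for each $m'\neq m$, and with probability $\bm P(m,m)$ keeps $m$ and attempts an increment $v\in\{(-1,0),(1,1),(0,-1)\}$, chosen with respective probabilities $\lambda(m),\mu_1(m),\mu_2(m)$: it moves to $(y+v,m)$ if $y+v\in\mathbb Z\times\mathbb Z_+$ and otherwise stays. A function $h$ on $\mathbb Z\times\mathbb Z_+\times\mathcal M$ is $(Y,M)$-harmonic if $\mathbb E_{(y,m)}[h(Y_1,M_1)]=h(y,m)$ for all $(y,m)$. $B=\{y\in\mathbb Z\times\mathbb Z_+:y(1)\ge y(2)\}$, $\tau=\inf\{k\ge0:Y_k(1)=Y_k(2)\}$. $[(\beta,\alpha,\bm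 d),(y,m)]=\beta^{y(1)-y(2)}\alpha^{y(2)}\bm d(m)$. $\bm A(\beta,\alpha)$ is the $\mathcal M\times\mathcal M$ matrix with off-diagonal entries $\bm P(m_1,m_2)$ and diagonal entries $\bm P(m,m)\big(\lambda(m)/\beta+\mu_1(m)\alpha+\mu_2(m)\beta/\alpha\big)$; for $\beta,\alpha>0$, $\Lambda_1(\beta,\alpha)$ is its largest (Perron–Frobenius) eigenvalue. $\bm c(\beta,\alpha,\bm d)(m)=\bm P(m,m)\mu_2(m)\bm d(m)(1-\beta/\alpha)$, $m\in\mathcal M$. Stability condition: $\sum_{m}(\lambda(m)-\mu_i(m))\bm\pi(m)\bm P(m,m)<0$, $i=1,2$. Under it $\rho_1$ is the unique number in $(0,1)$ with $\Lambda_1(\rho_1,\rho_1)=1$, and $\rho_2$ the unique number in $(0,1)$ with $\Lambda_1(\rho_2,1)=1$; $\bm d_1$, $\bm d_2$ are eigenvectors with strictly positive entries, for the eigenvalue $1$, of $\bm A(\rho_1,\rho_1)$ and $\bm A(\rho_2,1)$ respectively. $h_{\rho_1}=[(\rho_1,\rho_1,\bm d_1),\cdot]$. Condition (C): $\sum_{m}(\rho_2\mu_2(m)-\mu_1(m))\bm P(m,m)\det\big((\bm I-\bm A(\rho_2,1))^{m,m}\big)<0$, where $G^{m,m}$ is $G$ with row and column $m$ removed. Under it there is a unique $\alpha_1^*\in(0,1)$ with $\Lambda_1(\rho_2,\alpha_1^* )=1$. Assumption (E): for all $\beta,\alpha>0$ the matrix $\bm A(\beta,\alpha)$ has $|\mathcal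 M|$ distinct real eigenvalues, labelled $\Lambda_1>\Lambda_2>\dots>\Lambda_{|\mathcal M|}$. For $j=2,\dots,|\mathcal M|$, $\alpha_j^*\in(0,\alpha_1^* )$ is a number with $\Lambda_j(\rho_2,\alpha_j^* )=1$; for $j=1,\dots,|\mathcal M|$, $\bm d_{2,j}\in\mathbb R^{\mathcal M}\setminus\{0\}$ satisfies $\bm A(\rho_2,\alpha_j^* )\bm d_{2,j}=\bm d_{2,j}$. Span condition (S): $\bm c(\rho_2,1,\bm d_2)\in\mathrm{Span}\big(\bm c(\rho_2,\alpha_j^*,\bm d_{2,j}):j=1,\dots,|\mathcal M|\big)$. Under these assumptions there is a vector $\bm b_{2,1}\in\mathbb R^{|\mathcal M|}$ such that $\mathfrak h_{\rho_2}=[(\rho_2,1,\bm d_2),\cdot]+\sum_{j=1}^{|\mathcal M|}\bm b_{2,1}(j)[(\rho_2,\alpha_j^*,\bm d_{2,j}),\cdot]$ is $(Y,M)$-harmonic; $\mathfrak h_{\rho_2}$ denotes this function for a fixed such $\bm b_{2,1}$. *)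

theory Defs
  imports "HOL-Probability.Probability"
begin

primrec mpow :: "real^'n^'n \<Rightarrow> nat \<Rightarrow> real^'n^'n" where
  "mpow A 0 = mat 1"
| "mpow A (Suc k) = A ** mpow A k"

definition stochastic :: "real^'n^'n \<Rightarrow> bool" where
  "stochastic P \<longleftrightarrow> (\<forall>i j. 0 \<le> P $ i $ j) \<and> (\<forall>i. (\<Sum>j\<in>UNIV. P $ i $ j) = 1)"

definition irreducible_matrix :: "real^'n^'n \<Rightarrow> bool" where
  "irreducible_matrix P \<longleftrightarrow> (\<forall>i j. \<exists>k. 0 < mpow P k $ i $ j)"

definition aperiodic_matrix :: "real^'n^'n \<Rightarrow> bool" where
  "aperiodic_matrix P \<longleftrightarrow> (\<forall>i. Gcd {k. 0 < k \<and> 0 < mpow P k $ i $ i} = 1)"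

definition stationary_distribution :: "real^'n^'n \<Rightarrow> real^'n \<Rightarrow> bool" where
  "stationary_distribution P p \<longleftrightarrow>
     (\<forall>i. 0 \<le> p $ i) \<and> (\<Sum>i\<in>UNIV. p $ i) = 1 \<and> p v* P = p"

definition real_eigenvalues :: "real^'n^'n \<Rightarrow> real set" where
  "real_eigenvalues A = {x. \<exists>v. v \<noteq> 0 \<and> A *v v = x *s v}"

text \<open>The \<open>j\<close>-th largest real eigenvalue, counted from \<open>j = 1\<close>.\<close>

definition eigenvalue_nth :: "nat \<Rightarrow> real^'n^'n \<Rightarrow> real" where
  "eigenvalue_nth j A = rev (sorted_list_of_set (real_eigenvalues A)) ! (j - 1)"

text \<open>
  The determinant of \<open>A\<close> with row and column \<open>m\<close> removed: the Leibniz sum of \<^const>\<open>det\<close>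
  taken over the index set \<open>UNIV - {m}\<close> (so it is 1 if \<open>m\<close> is the only index).
\<close>

definition principal_minor :: "real^'n^'n \<Rightarrow> 'n \<Rightarrow> real" where
  "principal_minor A m =
     (\<Sum>p\<in>{p. p permutes (UNIV - {m})}. of_int (sign p) * (\<Prod>i\<in>UNIV - {m}. A $ i $ p i))"

type_synonym 'm state = "(int \<times> nat) \<times> 'm"

definition attempt :: "int \<times> nat \<Rightarrow> int \<times> int \<Rightarrow> int \<times> nat" where
  "attempt y v = (if 0 \<le> int (snd y) + snd v
                  then (fst y + fst v, nat (int (snd y) + snd v)) else y)"

definition increment_pmf ::
  "('m \<Rightarrow> real) \<Rightarrow> ('m \<Rightarrow> real) \<Rightarrow> ('m \<Rightarrow> real) \<Rightarrow> 'm \<Rightarrow> (int \<times> int) pmf" where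
  "increment_pmf lam mu1 mu2 m = embed_pmf (\<lambda>v.
     if v = (-1, 0) then lam m else if v = (1, 1) then mu1 m else if v = (0, -1) then mu2 m else 0)"

definition step_pmf ::
  "real^'m^'m \<Rightarrow> ('m \<Rightarrow> real) \<Rightarrow> ('m \<Rightarrow> real) \<Rightarrow> ('m \<Rightarrow> real) \<Rightarrow> 'm state \<Rightarrow> 'm state pmf" where
  "step_pmf P lam mu1 mu2 s = (case s of (y, m) \<Rightarrow>
     bind_pmf (embed_pmf (\<lambda>m'. P $ m $ m')) (\<lambda>m'.
       if m' \<noteq> m then return_pmf (y, m')
       else map_pmf (\<lambda>v. (attempt y v, m)) (increment_pmf lam mu1 mu2 m)))"

definition harmonic :: "('s \<Rightarrow> 's pmf) \<Rightarrow> ('s \<Rightarrow> real) \<Rightarrow> bool" where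
  "harmonic K h \<longleftrightarrow> (\<forall>s. measure_pmf.expectation (K s) h = h s)"

text \<open>
  \<open>Pr s\<close> is a law on the sample space under which the process \<open>X\<close> is the Markov chain with
  transition kernel \<open>K\<close> started from \<open>s\<close>.
\<close>

definition markov_chain ::
  "('s :: countable \<Rightarrow> 's pmf) \<Rightarrow> ('s \<Rightarrow> 'w measure) \<Rightarrow> (nat \<Rightarrow> 'w \<Rightarrow> 's) \<Rightarrow> bool" where
  "markov_chain K Pr X \<longleftrightarrow> (\<forall>s.
     prob_space (Pr s) \<and>
     (\<forall>n. X n \<in> Pr s \<rightarrow>\<^sub>M count_space UNIV) \<and>
     measure (Pr s) {w \<in> space (Pr s). X 0 w = s} = 1 \<and>
     (\<forall>n x. measure (Pr s) {w \<in> space (Pr s). \<forall>i\<le>Suc n. X i w = x i} =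
            measure (Pr s) {w \<in> space (Pr s). \<forall>i\<le>n. X i w = x i} * pmf (K (x n)) (x (Suc n))))"

definition tau :: "(nat \<Rightarrow> 'm state) \<Rightarrow> enat" where
  "tau x = Inf (enat ` {k. fst (fst (x k)) = int (snd (fst (x k)))})"

definition B_region :: "(int \<times> nat) set" where
  "B_region = {y. int (snd y) \<le> fst y}"

definition loglin :: "real \<Rightarrow> real \<Rightarrow> real^'m \<Rightarrow> 'm state \<Rightarrow> real" where
  "loglin \<beta> \<alpha> d s = (case s of (y, m) \<Rightarrow>
     \<beta> powi (fst y - int (snd y)) * \<alpha> ^ snd y * d $ m)"

definition A_matrix ::
  "real^'m^'m \<Rightarrow> ('m \<Rightarrow> real) \<Rightarrow> ('m \<Rightarrow> real) \<Rightarrow> ('m \<Rightarrow> real) \<Rightarrow> real \<Rightarrow> real \<Rightarrow> real^'m^'m" where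
  "A_matrix P lam mu1 mu2 \<beta> \<alpha> = (\<chi> m1 m2.
     if m1 = m2 then P $ m1 $ m1 * (lam m1 / \<beta> + mu1 m1 * \<alpha> + mu2 m1 * (\<beta> / \<alpha>))
     else P $ m1 $ m2)"

definition c_vec ::
  "real^'m^'m \<Rightarrow> ('m \<Rightarrow> real) \<Rightarrow> real \<Rightarrow> real \<Rightarrow> real^'m \<Rightarrow> real^'m" where
  "c_vec P mu2 \<beta> \<alpha> d = (\<chi> m. P $ m $ m * mu2 m * d $ m * (1 - \<beta> / \<alpha>))"

end

theory Submission
  imports Defs
begin

text \<open>
  Perturbing the constant vector along a solution of the Poisson equation of \<open>P\<close>, the two drift
  conditions yield, for some \<open>\<beta> < 1\<close> above \<open>\<rho>1\<close> and \<open>\<rho>2\<close>, positive vectors that \<open>A(\<beta>, \<beta>)\<close> and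
  \<open>A(\<beta>, 1)\<close> contract strictly. A combination \<open>V\<close> of the two log-linear functions then decays
  geometrically in mean along the chain: the first one, which has no defect at the boundary
  \<open>y(2) = 0\<close>, absorbs the defect of the second. Since \<open>\<beta> ^ (y(1) - y(2)) \<le> V\<close>, any combination of
  \<open>h2\<close> and \<open>h1\<close> is dominated by \<open>V\<close> on \<open>B\<close>, so it equals the expectation of its value at the
  hitting time of the diagonal. On the diagonal it is bounded, and, \<open>h2\<close> tending to \<open>d2 > 0\<close>
  there, bounded away from 0 once enough of \<open>h1\<close> has been added; this gives both inequalities.
\<close>

section \<open>Stochastic matrices: fixed vectors and the Poisson equation\<close>

lemma mpow_fixed: "P *v u = u \<Longrightarrow> mpow P k *v u = u"
  by (induction k) (simp_all flip: matrix_vector_mul_assoc)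

lemma mpow_nonneg: "stochastic P \<Longrightarrow> 0 \<le> mpow P k $ i $ j"
proof (induction k arbitrary: i j)
  case (Suc k)
  then show ?case
    by (auto simp: matrix_matrix_mult_def stochastic_def intro!: sum_nonneg)
qed (simp add: mat_def)

lemma stochastic_mult_one: "stochastic P \<Longrightarrow> P *v 1 = 1"
  by (simp add: vec_eq_iff matrix_vector_mult_def stochastic_def)

text \<open>Maximum principle: at a maximising index \<open>i\<close> the nonnegative vector
  \<open>u $ i *s 1 - u\<close> vanishes, and every power of \<open>P\<close> fixes it. A power with
  positive \<open>(i, j)\<close> entry then forces \<open>u $ j = u $ i\<close>.\<close>

lemma irreducible_fixed_const:
  fixes P :: "real^'n^'n"
  assumes P: "stochastic P" "irreducible_matrix P" and u: "P *v u = u"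
  shows "\<exists>c. u = c *s 1"
proof -
  obtain i where i: "\<And>j. u $ j \<le> u $ i"
    using finite_imageI[OF finite_class.finite_UNIV, of "($) u"]
    by (metis (mono_tags, lifting) Max_ge Max_in UNIV_not_empty image_iff image_is_empty rangeI)
  have "u $ j = u $ i" for j
  proof -
    obtain k where k: "0 < mpow P k $ i $ j"
      using P(2) unfolding irreducible_matrix_def by blast
    have "mpow P k *v (u $ i *s 1 - u) = u $ i *s 1 - u"
      using stochastic_mult_one[OF P(1)] u
      by (intro mpow_fixed) (simp add: matrix_vector_mult_diff_distrib vector_scalar_commute)
    then have "(\<Sum>l\<in>UNIV. mpow P k $ i $ l * (u $ i - u $ l)) = 0"
      by (auto simp: vec_eq_iff matrix_vector_mult_def dest!: spec[of _ i])
    then have "mpow P k $ i $ j * (u $ i - u $ j) = 0"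
      using i by (subst (asm) sum_nonneg_eq_0_iff) (auto intro!: mult_nonneg_nonneg mpow_nonneg P)
    with k show ?thesis by simp
  qed
  then show ?thesis by (intro exI[of _ "u $ i"]) (simp add: vec_eq_iff)
qed

text \<open>
  The correction term \<open>(p \<bullet> u) *s 1\<close> makes the map \<open>u \<mapsto> P u - u\<close> injective, hence onto.
\<close>

lemma poisson_equation:
  fixes P :: "real^'n^'n" and g :: "real^'n"
  assumes P: "stochastic P" "irreducible_matrix P" and p: "stationary_distribution P p"
  shows "\<exists>u. \<forall>m. g $ m + (P *v u) $ m - u $ m = p \<bullet> g"
proof -
  have p1: "p \<bullet> (c *s 1) = c" for c
    using p by (simp add: inner_vec_def stationary_distribution_def flip: sum_distrib_right)
  have pP: "p \<bullet> (P *v u) = p \<bullet> u" for u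
    using p by (simp add: stationary_distribution_def flip: dot_lmul_matrix)
  define f where "f u = P *v u - u + (p \<bullet> u) *s 1" for u
  have pf: "p \<bullet> f u = p \<bullet> u" for u
    by (simp add: f_def inner_right_distrib inner_diff_right p1 pP)
  have lin: "linear f"
    by (rule linearI)
       (simp_all add: f_def vec_eq_iff matrix_vector_right_distrib inner_right_distrib
          vector_scalar_commute scalar_mult_eq_scaleR algebra_simps)
  have "inj f"
  proof (subst linear_injective_0[OF lin], intro allI impI)
    fix u assume fu: "f u = 0"
    then have "p \<bullet> u = 0" using pf[of u] by simp
    moreover from this fu have "P *v u = u" by (simp add: f_def)
    then obtain c where "u = c *s 1" using irreducible_fixed_const[OF P] by blast
    ultimately show "u = 0" using p1 by simp
  qed
  with lin have "surj f" by (rule linear_injective_imp_surjective) simp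
  \<comment> \<open>The target has \<open>p\<close>-mean zero and \<open>f\<close> preserves the
    \<open>p\<close>-mean, so the correction term vanishes at the preimage.\<close>
  then obtain u where u: "f u = (p \<bullet> g) *s 1 - g" by (metis surjD)
  then have "p \<bullet> u = 0" using pf[of u] by (simp add: inner_diff_right p1)
  with u have "P *v u - u = (p \<bullet> g) *s 1 - g" by (simp add: f_def)
  then show ?thesis by (intro exI[of _ u]) (simp add: vec_eq_iff algebra_simps)
qed

section \<open>Supersolutions for \<open>\<beta>\<close> slightly below 1\<close>

text \<open>To first order in \<open>x\<close>, row \<open>m\<close> of the product is
  \<open>1 + x * ((P *v u) $ m + P $ m $ m * s m)\<close>. Taking \<open>u\<close> from the Poisson
  equation replaces the drifts of the single modes by their stationary mean, which
  \<open>neg\<close> makes negative, so one \<open>u\<close> contracts in all rows at once.\<close>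

lemma first_order_supersolution:
  fixes P :: "real^'n^'n" and w :: "'n \<Rightarrow> real \<Rightarrow> real"
  assumes P: "stochastic P" "irreducible_matrix P" and p: "stationary_distribution P p"
    and w: "\<And>m. w m 0 = 1" "\<And>m. (w m has_real_derivative s m) (at 0)"
    and neg: "(\<Sum>m\<in>UNIV. s m * p $ m * P $ m $ m) < 0"
  shows "\<exists>u \<delta>. 0 < \<delta> \<and> (\<forall>\<^sub>F x in at_right 0. \<forall>m. 0 < 1 + x * u $ m \<and>
     ((\<chi> i j. if i = j then P $ i $ i * w i x else P $ i $ j) *v (\<chi> j. 1 + x * u $ j)) $ m
       \<le> (1 - \<delta> * x) * (1 + x * u $ m))"
proof -
  define g :: "real^'n" where "g = (\<chi> m. P $ m $ m * s m)"
  have pg: "p \<bullet> g < 0"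
    using neg by (simp add: inner_vec_def g_def mult_ac)
  obtain u where u: "\<And>m. g $ m + (P *v u) $ m - u $ m = p \<bullet> g"
    using poisson_equation[OF P p] by blast
  \<comment> \<open>Half of the mean drift becomes the contraction rate; the other half keeps the
    derivative of \<open>F\<close> at 0 negative.\<close>
  define \<delta> where "\<delta> = - (p \<bullet> g) / 2"
  have row: "((\<chi> i j. if i = j then P $ i $ i * w i x else P $ i $ j) *v (\<chi> j. 1 + x * u $ j)) $ m
      = 1 + x * (P *v u) $ m + P $ m $ m * (w m x - 1) * (1 + x * u $ m)" for x m
  proof -
    have "(\<Sum>j\<in>UNIV. (if m = j then P $ m $ m * w m x else P $ m $ j) * (1 + x * u $ j))
        = (\<Sum>j\<in>UNIV. P $ m $ j * (1 + x * u $ j)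
             + (if m = j then P $ m $ m * (w m x - 1) * (1 + x * u $ m) else 0))"
      by (rule sum.cong) (auto simp: algebra_simps)
    also have "\<dots> = (\<Sum>j\<in>UNIV. P $ m $ j) + x * (\<Sum>j\<in>UNIV. P $ m $ j * u $ j)
         + P $ m $ m * (w m x - 1) * (1 + x * u $ m)"
      by (simp add: sum.distrib sum_distrib_left distrib_left mult_ac)
    finally show ?thesis
      using P(1) by (simp add: matrix_vector_mult_def stochastic_def)
  qed
  have ev: "\<forall>\<^sub>F x in at_right 0. 0 < 1 + x * u $ m \<and>
     ((\<chi> i j. if i = j then P $ i $ i * w i x else P $ i $ j) *v (\<chi> j. 1 + x * u $ j)) $ m
       \<le> (1 - \<delta> * x) * (1 + x * u $ m)" for m
  proof (intro eventually_conj)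
    have "((\<lambda>x. 1 + x * u $ m) \<longlongrightarrow> 1 + 0 * u $ m) (at_right 0)"
      by (intro tendsto_intros)
    then show "\<forall>\<^sub>F x in at_right 0. 0 < 1 + x * u $ m"
      by (rule order_tendstoD) simp
    define F where "F x = 1 + x * (P *v u) $ m + P $ m $ m * (w m x - 1) * (1 + x * u $ m)
        - (1 - \<delta> * x) * (1 + x * u $ m)" for x
    have "(F has_real_derivative (P *v u) $ m + P $ m $ m * s m + \<delta> - u $ m) (at 0)"
      unfolding F_def by (auto intro!: derivative_eq_intros w simp: w(1))
    moreover have "(P *v u) $ m + P $ m $ m * s m + \<delta> - u $ m < 0"
      using u[of m] pg by (simp add: g_def \<delta>_def field_simps)
    ultimately have "\<exists>d>0. \<forall>x>0. 0 + x \<in> UNIV \<longrightarrow> x < d \<longrightarrow> F (0 + x) < F 0"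
      by (rule has_real_derivative_neg_dec_right)
    then obtain d where "0 < d" and d: "\<And>x. 0 < x \<Longrightarrow> x < d \<Longrightarrow> F x < F 0"
      by (metis UNIV_I add_0)
    have "F 0 = 0" by (simp add: F_def w)
    then have "\<forall>\<^sub>F x in at_right 0. F x \<le> 0"
      using \<open>0 < d\<close> d by (auto simp: eventually_at_right_field intro!: exI[of _ d] less_imp_le)
    then show "\<forall>\<^sub>F x in at_right 0.
       ((\<chi> i j. if i = j then P $ i $ i * w i x else P $ i $ j) *v (\<chi> j. 1 + x * u $ j)) $ m
       \<le> (1 - \<delta> * x) * (1 + x * u $ m)"
      by eventually_elim (simp add: row F_def)
  qed
  have "0 < \<delta>" using pg by (simp add: \<delta>_def)
  then show ?thesis
    by (intro exI[of _ u] exI[of _ \<delta>] conjI eventually_all_finite ev)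
qed

text \<open>With \<open>\<beta> = 1 - x\<close>, the diagonal factors of
  \<open>A(\<beta>, \<beta>)\<close> and \<open>A(\<beta>, 1)\<close> equal 1 at
  \<open>x = 0\<close> and have slopes \<open>lam m - mu1 m\<close> and \<open>lam m - mu2 m\<close>
  there, so each stability condition is the drift condition of one matrix. Both contractions hold
  for all small \<open>x > 0\<close>, hence for a common one.\<close>

lemma A_matrix_supersolutions:
  fixes P :: "real^'m^'m" and r :: real
  assumes P: "stochastic P" "irreducible_matrix P" and p: "stationary_distribution P p"
    and rates: "\<And>m. lam m + mu1 m + mu2 m = 1"
    and stability: "(\<Sum>m\<in>UNIV. (lam m - mu1 m) * p $ m * P $ m $ m) < 0"
                   "(\<Sum>m\<in>UNIV. (lam m - mu2 m) * p $ m * P $ m $ m) < 0"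
    and r: "r < 1"
  shows "\<exists>\<beta> \<theta>1 \<theta>2 e1 e2. 0 < \<beta> \<and> r \<le> \<beta> \<and> \<beta> < 1 \<and> \<theta>1 < 1 \<and> \<theta>2 < 1 \<and>
     (\<forall>m. 0 < e1 $ m \<and> 0 < e2 $ m \<and>
       (A_matrix P lam mu1 mu2 \<beta> \<beta> *v e1) $ m \<le> \<theta>1 * e1 $ m \<and>
       (A_matrix P lam mu1 mu2 \<beta> 1 *v e2) $ m \<le> \<theta>2 * e2 $ m)"
proof -
  define w1 where "w1 m x = lam m / (1 - x) + mu1 m * (1 - x) + mu2 m" for m and x :: real
  define w2 where "w2 m x = lam m / (1 - x) + mu1 m + mu2 m * (1 - x)" for m and x :: real
  have w10: "w1 m 0 = 1" and w20: "w2 m 0 = 1" for m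
    using rates[of m] by (simp_all add: w1_def w2_def)
  have w1': "(w1 m has_real_derivative lam m - mu1 m) (at 0)"
    and w2': "(w2 m has_real_derivative lam m - mu2 m) (at 0)" for m
    unfolding w1_def w2_def by (auto intro!: derivative_eq_intros)
  obtain u1 \<delta>1 where 1: "0 < \<delta>1" "\<forall>\<^sub>F x in at_right 0. \<forall>m. 0 < 1 + x * u1 $ m \<and>
     ((\<chi> i j. if i = j then P $ i $ i * w1 i x else P $ i $ j) *v (\<chi> j. 1 + x * u1 $ j)) $ m
       \<le> (1 - \<delta>1 * x) * (1 + x * u1 $ m)"
    using first_order_supersolution[of P p w1, OF P p w10 w1' stability(1)] by blast
  obtain u2 \<delta>2 where 2: "0 < \<delta>2" "\<forall>\<^sub>F x in at_right 0. \<forall>m. 0 < 1 + x * u2 $ m \<and>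
     ((\<chi> i j. if i = j then P $ i $ i * w2 i x else P $ i $ j) *v (\<chi> j. 1 + x * u2 $ j)) $ m
       \<le> (1 - \<delta>2 * x) * (1 + x * u2 $ m)"
    using first_order_supersolution[of P p w2, OF P p w20 w2' stability(2)] by blast
  have "\<forall>\<^sub>F x in at_right (0::real). 0 < x \<and> x < 1 \<and> x < 1 - r"
    using r by (auto simp: eventually_at_right_field intro!: exI[of _ "min 1 (1 - r)"])
  with 1(2) 2(2) have "\<forall>\<^sub>F x in at_right 0. (\<forall>m. 0 < 1 + x * u1 $ m \<and>
     ((\<chi> i j. if i = j then P $ i $ i * w1 i x else P $ i $ j) *v (\<chi> j. 1 + x * u1 $ j)) $ m
       \<le> (1 - \<delta>1 * x) * (1 + x * u1 $ m)) \<and> (\<forall>m. 0 < 1 + x * u2 $ m \<and>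
     ((\<chi> i j. if i = j then P $ i $ i * w2 i x else P $ i $ j) *v (\<chi> j. 1 + x * u2 $ j)) $ m
       \<le> (1 - \<delta>2 * x) * (1 + x * u2 $ m)) \<and> 0 < x \<and> x < 1 \<and> x < 1 - r"
    by (simp only: eventually_conj_iff)
  then obtain x where x: "(\<forall>m. 0 < 1 + x * u1 $ m \<and>
     ((\<chi> i j. if i = j then P $ i $ i * w1 i x else P $ i $ j) *v (\<chi> j. 1 + x * u1 $ j)) $ m
       \<le> (1 - \<delta>1 * x) * (1 + x * u1 $ m)) \<and> (\<forall>m. 0 < 1 + x * u2 $ m \<and>
     ((\<chi> i j. if i = j then P $ i $ i * w2 i x else P $ i $ j) *v (\<chi> j. 1 + x * u2 $ j)) $ m
       \<le> (1 - \<delta>2 * x) * (1 + x * u2 $ m)) \<and> 0 < x \<and> x < 1 \<and> x < 1 - r"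
    using eventually_happens'[OF trivial_limit_at_right_real] by blast
  have A1: "A_matrix P lam mu1 mu2 (1 - x) (1 - x)
      = (\<chi> i j. if i = j then P $ i $ i * w1 i x else P $ i $ j)"
    and A2: "A_matrix P lam mu1 mu2 (1 - x) 1
      = (\<chi> i j. if i = j then P $ i $ i * w2 i x else P $ i $ j)"
    using x by (simp_all add: A_matrix_def w1_def w2_def vec_eq_iff)
  show ?thesis
    using x 1(1) 2(1)
    by (intro exI[of _ "1 - x"] exI[of _ "1 - \<delta>1 * x"] exI[of _ "1 - \<delta>2 * x"]
          exI[of _ "\<chi> m. 1 + x * u1 $ m"] exI[of _ "\<chi> m. 1 + x * u2 $ m"])
       (simp add: A1 A2)
qed

section \<open>One-step law of the chain and its expectations\<close>

text \<open>Supplies the normalisation that \<open>pmf_embed_pmf\<close> demands, for densities of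
  finite support.\<close>

lemma nn_integral_count_space_sum:
  fixes f :: "'a \<Rightarrow> real"
  assumes "finite A" "\<And>x. 0 \<le> f x" "\<And>x. x \<notin> A \<Longrightarrow> f x = 0"
  shows "(\<integral>\<^sup>+x. ennreal (f x) \<partial>count_space UNIV) = ennreal (\<Sum>x\<in>A. f x)"
  using assms by (subst nn_integral_count_space'[of A]) (auto simp: sum_ennreal)

lemma pmf_mode:
  assumes "stochastic (P :: real^'m^'m)"
  shows "pmf (embed_pmf (\<lambda>m'. P $ m $ m')) x = P $ m $ x"
proof (rule pmf_embed_pmf)
  show "(\<integral>\<^sup>+m'. ennreal (P $ m $ m') \<partial>count_space UNIV) = 1"
    using assms by (subst nn_integral_count_space_sum[of UNIV]) (auto simp: stochastic_def)
qed (use assms in \<open>simp add: stochastic_def\<close>)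

lemma pmf_increment:
  assumes "0 \<le> lam m" "0 \<le> mu1 m" "0 \<le> mu2 m" "lam m + mu1 m + mu2 m = 1"
  shows "pmf (increment_pmf lam mu1 mu2 m) v =
    (if v = (-1, 0) then lam m else if v = (1, 1) then mu1 m else if v = (0, -1) then mu2 m else 0)"
proof -
  let ?f = "\<lambda>v::int \<times> int.
    if v = (-1, 0) then lam m else if v = (1, 1) then mu1 m else if v = (0, -1) then mu2 m else 0"
  have "(\<integral>\<^sup>+v. ennreal (?f v) \<partial>count_space UNIV) = ennreal (\<Sum>v\<in>{(-1, 0), (1, 1), (0, -1)}. ?f v)"
    using assms by (intro nn_integral_count_space_sum) auto
  also have "\<dots> = 1" using assms by (simp add: add.assoc)
  finally show ?thesis
    unfolding increment_pmf_def using assms by (intro pmf_embed_pmf) auto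
qed

lemma set_increment:
  assumes "0 \<le> lam m" "0 \<le> mu1 m" "0 \<le> mu2 m" "lam m + mu1 m + mu2 m = 1"
  shows "set_pmf (increment_pmf lam mu1 mu2 m) \<subseteq> {(-1, 0), (1, 1), (0, -1)}"
  by (auto simp: set_pmf_iff pmf_increment[of lam m mu1 mu2, OF assms] split: if_splits)

context
  fixes P :: "real^'m^'m" and lam mu1 mu2 :: "'m \<Rightarrow> real"
  assumes P: "stochastic P"
    and rates: "\<And>m. 0 < lam m" "\<And>m. 0 < mu1 m" "\<And>m. 0 < mu2 m"
               "\<And>m. lam m + mu1 m + mu2 m = 1"
begin

lemma set_step:
  "set_pmf (step_pmf P lam mu1 mu2 (y, m)) \<subseteq>
     {y} \<times> UNIV \<union> {attempt y (-1, 0), attempt y (1, 1), attempt y (0, -1)} \<times> {m}"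
  using set_increment[of lam m mu1 mu2] rates[of m]
  by (fastforce simp: step_pmf_def split: if_splits)

lemma finite_set_step: "finite (set_pmf (step_pmf P lam mu1 mu2 s))"
  by (cases s) (auto intro: finite_subset[OF set_step])

lemma expectation_step:
  fixes f :: "'m state \<Rightarrow> real"
  shows "measure_pmf.expectation (step_pmf P lam mu1 mu2 (y, m)) f =
    (\<Sum>m'\<in>UNIV. P $ m $ m' * (if m' = m then lam m * f (attempt y (-1, 0), m)
       + mu1 m * f (attempt y (1, 1), m) + mu2 m * f (attempt y (0, -1), m) else f (y, m')))"
proof -
  let ?I = "increment_pmf lam mu1 mu2 m"
  have sub: "set_pmf ?I \<subseteq> {(-1, 0), (1, 1), (0, -1)}"
    using set_increment[of lam m mu1 mu2] rates[of m] by simp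
  have "measure_pmf.expectation ?I (\<lambda>v. f (attempt y v, m)) =
      (\<Sum>v\<in>{(-1, 0), (1, 1), (0, -1)}. f (attempt y v, m) * pmf ?I v)"
    using sub by (intro integral_measure_pmf_real) auto
  also have "\<dots> = lam m * f (attempt y (-1, 0), m)
       + mu1 m * f (attempt y (1, 1), m) + mu2 m * f (attempt y (0, -1), m)"
    using rates[of m] by (simp add: pmf_increment)
  finally have *: "measure_pmf.expectation ?I (\<lambda>v. f (attempt y v, m)) = \<dots>" .
  have fin: "finite (set_pmf ?I)" using sub by (rule finite_subset) simp
  show ?thesis
    unfolding step_pmf_def prod.case
    by (subst pmf_expectation_bind[of UNIV])
       (auto simp: fin pmf_mode[OF P] * intro!: sum.cong)
qed

text \<open>Each accepted increment multiplies the function by the factor attached to its rate in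
  \<open>A_matrix\<close>. At \<open>k = 0\<close> the attempt \<open>(0, -1)\<close> is rejected,
  so its factor is 1 in place of \<open>\<beta> / \<alpha>\<close>; \<open>c_vec\<close> records the
  difference.\<close>

lemma expectation_loglin:
  assumes "0 < \<beta>" "0 < \<alpha>"
  shows "measure_pmf.expectation (step_pmf P lam mu1 mu2 ((y, k), m)) (loglin \<beta> \<alpha> d) =
    \<beta> powi (y - int k) * \<alpha> ^ k *
      ((A_matrix P lam mu1 mu2 \<beta> \<alpha> *v d) $ m + (if k = 0 then c_vec P mu2 \<beta> \<alpha> d $ m else 0))"
proof -
  define q where "q = \<beta> powi (y - int k) * \<alpha> ^ k"
  have down: "loglin \<beta> \<alpha> d (attempt (y, k) (-1, 0), m) = q * d $ m / \<beta>"
    using assms by (simp add: loglin_def attempt_def q_def power_int_diff)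
  have up: "loglin \<beta> \<alpha> d (attempt (y, k) (1, 1), m) = q * d $ m * \<alpha>"
    using assms by (simp add: loglin_def attempt_def q_def nat_add_distrib)
  have left: "loglin \<beta> \<alpha> d (attempt (y, k) (0, -1), m) =
      q * d $ m * (\<beta> / \<alpha> + (if k = 0 then 1 - \<beta> / \<alpha> else 0))"
  proof (cases k)
    case (Suc l)
    then show ?thesis using assms
      by (simp add: loglin_def attempt_def q_def power_int_diff power_int_add nat_diff_distrib)
  qed (simp add: loglin_def attempt_def q_def)
  have stay: "loglin \<beta> \<alpha> d ((y, k), m') = q * d $ m'" for m'
    by (simp add: loglin_def q_def)
  have "measure_pmf.expectation (step_pmf P lam mu1 mu2 ((y, k), m)) (loglin \<beta> \<alpha> d) =
    (\<Sum>m'\<in>UNIV. q * (A_matrix P lam mu1 mu2 \<beta> \<alpha> $ m $ m' * d $ m')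
       + (if m' = m then q * (if k = 0 then c_vec P mu2 \<beta> \<alpha> d $ m else 0) else 0))"
    unfolding expectation_step down up left stay
    by (rule sum.cong) (auto simp: A_matrix_def c_vec_def algebra_simps)
  also have "\<dots> = q * ((A_matrix P lam mu1 mu2 \<beta> \<alpha> *v d) $ m
      + (if k = 0 then c_vec P mu2 \<beta> \<alpha> d $ m else 0))"
    by (simp add: sum.distrib matrix_vector_mult_def sum_distrib_left distrib_left)
  finally show ?thesis by (simp add: q_def)
qed

end

section \<open>Path laws and hitting probabilities\<close>

text \<open>Law of the first \<open>n + 1\<close> states, start included.
  \<open>markov_chain\<close> extends cylinders at the end of the path; this recursion splits off
  the first step instead, as first-step analysis needs.\<close>

primrec path_pmf :: "('s \<Rightarrow> 's pmf) \<Rightarrow> nat \<Rightarrow> 's \<Rightarrow> 's list pmf" where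
  "path_pmf K 0 s = return_pmf [s]"
| "path_pmf K (Suc n) s = bind_pmf (K s) (\<lambda>t. map_pmf ((#) s) (path_pmf K n t))"

lemma pmf_path:
  "pmf (path_pmf K n s) xs =
    (if length xs = Suc n \<and> xs ! 0 = s then \<Prod>i<n. pmf (K (xs ! i)) (xs ! Suc i) else 0)"
proof (induction n arbitrary: s xs)
  case 0
  then show ?case by (cases xs) (auto simp: pmf_return)
next
  case (Suc n)
  show ?case
  proof (cases "\<exists>ys. xs = s # ys")
    case False
    then have "pmf (map_pmf ((#) s) (path_pmf K n t)) xs = 0" for t
      by (intro pmf_map_outside) auto
    with False show ?thesis by (cases xs) (auto simp: pmf_bind)
  next
    case True
    then obtain ys where xs: "xs = s # ys" by blast
    have "pmf (map_pmf ((#) s) (path_pmf K n t)) (s # ys) = pmf (path_pmf K n t) ys" for t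
      by (intro pmf_map_inj') simp
    then have "pmf (path_pmf K (Suc n) s) xs =
        measure_pmf.expectation (K s) (\<lambda>t. pmf (path_pmf K n t) ys)"
      by (simp add: pmf_bind xs)
    \<comment> \<open>A path from \<open>t\<close> begins with \<open>t\<close>, so only
      \<open>t = ys ! 0\<close> can contribute.\<close>
    also have "\<dots> = (\<Sum>t\<in>{ys ! 0}. pmf (path_pmf K n t) ys * pmf (K s) t)"
      by (intro integral_measure_pmf_real) (auto simp: Suc split: if_splits)
    also have "\<dots> = (if length xs = Suc (Suc n) \<and> xs ! 0 = s
        then \<Prod>i<Suc n. pmf (K (xs ! i)) (xs ! Suc i) else 0)"
      by (simp add: Suc xs prod.lessThan_Suc_shift mult.commute del: prod.lessThan_Suc)
    finally show ?thesis .
  qed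
qed

lemma markov_chain_cylinder:
  assumes "markov_chain K Pr X"
  shows "measure (Pr s) {w \<in> space (Pr s). \<forall>i\<le>n. X i w = x i} =
    (if x 0 = s then \<Prod>i<n. pmf (K (x i)) (x (Suc i)) else 0)"
proof (induction n)
  case 0
  interpret prob_space "Pr s" using assms by (simp add: markov_chain_def)
  have [measurable]: "X 0 \<in> Pr s \<rightarrow>\<^sub>M count_space UNIV"
    using assms by (simp add: markov_chain_def)
  have s: "prob {w \<in> space (Pr s). X 0 w = s} = 1"
    using assms by (simp add: markov_chain_def)
  show ?case
  proof (cases "x 0 = s")
    case False
    have ae: "AE w in Pr s. X 0 w = s"
      using s by (subst (asm) prob_Collect_eq_1) auto
    have "prob {w \<in> space (Pr s). X 0 w = x 0} = 0"
      by (subst prob_Collect_eq_0) (use ae False in \<open>auto elim!: eventually_mono\<close>)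
    with False show ?thesis by simp
  qed (use s in simp)
next
  case (Suc n)
  then show ?case using assms by (simp add: markov_chain_def del: All_less_Suc)
qed

text \<open>Carries events about the first \<open>n + 1\<close> states from \<open>Pr s\<close> to
  \<open>path_pmf\<close>. Lists over a countable type are countable, so the two laws agree once
  they agree on single lists, and there both are cylinder probabilities.\<close>

lemma markov_chain_distr:
  fixes K :: "'s::countable \<Rightarrow> 's pmf"
  assumes mc: "markov_chain K Pr X"
  shows "measure (Pr s) {w \<in> space (Pr s). Q (map (\<lambda>i. X i w) [0..<Suc n])} =
    measure_pmf.prob (path_pmf K n s) {xs. Q xs}"
proof -
  interpret prob_space "Pr s" using mc by (simp add: markov_chain_def)
  have X[measurable]: "X i \<in> Pr s \<rightarrow>\<^sub>M count_space UNIV" for i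
    using mc by (simp add: markov_chain_def)
  let ?L = "\<lambda>w. map (\<lambda>i. X i w) [0..<Suc n]"
  have pre: "{w \<in> space (Pr s). ?L w = xs} =
      (if length xs = Suc n then {w \<in> space (Pr s). \<forall>i\<le>n. X i w = xs ! i} else {})" for xs
    by (auto simp: list_eq_iff_nth_eq less_Suc_eq_le simp del: upt_Suc)
  have L[measurable]: "?L \<in> Pr s \<rightarrow>\<^sub>M count_space UNIV"
  proof (subst measurable_count_space_eq2_countable, safe)
    fix xs :: "'s list"
    have "{w \<in> space (Pr s). ?L w = xs} \<in> sets (Pr s)"
      unfolding pre by auto
    moreover have "?L -` {xs} \<inter> space (Pr s) = {w \<in> space (Pr s). ?L w = xs}" by auto
    ultimately show "?L -` {xs} \<inter> space (Pr s) \<in> sets (Pr s)" by simp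
  qed auto
  have "distr (Pr s) (count_space UNIV) ?L = measure_pmf (path_pmf K n s)"
  proof (rule measure_eqI_countable[of _ UNIV])
    fix xs :: "'s list"
    have "emeasure (distr (Pr s) (count_space UNIV) ?L) {xs} =
        emeasure (Pr s) {w \<in> space (Pr s). ?L w = xs}"
      by (subst emeasure_distr[OF L]) (auto intro!: arg_cong[where f = "emeasure (Pr s)"])
    also have "\<dots> = ennreal (pmf (path_pmf K n s) xs)"
      unfolding emeasure_eq_measure pre
      by (auto simp: markov_chain_cylinder[OF mc] pmf_path)
    finally show "emeasure (distr (Pr s) (count_space UNIV) ?L) {xs} =
        emeasure (measure_pmf (path_pmf K n s)) {xs}"
      by (simp add: emeasure_pmf_single)
  qed auto
  then have "measure_pmf.prob (path_pmf K n s) {xs. Q xs} =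
      measure (distr (Pr s) (count_space UNIV) ?L) {xs. Q xs}" by simp
  also have "\<dots> = measure (Pr s) {w \<in> space (Pr s). Q (?L w)}"
    by (subst measure_distr[OF L]) (auto intro!: arg_cong[where f = "measure (Pr s)"])
  finally show ?thesis by simp
qed

definition hit_within :: "('s \<Rightarrow> 's pmf) \<Rightarrow> 's set \<Rightarrow> nat \<Rightarrow> 's \<Rightarrow> real" where
  "hit_within K D n s = measure_pmf.prob (path_pmf K n s) {xs. \<exists>x\<in>set xs. x \<in> D}"

lemma start_in_path: "xs \<in> set_pmf (path_pmf K n s) \<Longrightarrow> s \<in> set xs"
  by (cases n) auto

lemma hit_within_in: "s \<in> D \<Longrightarrow> hit_within K D n s = 1"
  unfolding hit_within_def
  by (subst measure_pmf.prob_eq_1) (auto simp: AE_measure_pmf_iff dest: start_in_path)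

lemma hit_within_0: "s \<notin> D \<Longrightarrow> hit_within K D 0 s = 0"
  by (simp add: hit_within_def)

text \<open>First-step analysis: off \<open>D\<close> the starting state is no hit, so only the path
  from the next state matters.\<close>

lemma hit_within_Suc:
  assumes "s \<notin> D"
  shows "hit_within K D (Suc n) s = measure_pmf.expectation (K s) (hit_within K D n)"
proof -
  have "hit_within K D (Suc n) s = measure_pmf.expectation (K s)
     (\<lambda>t. measure_pmf.prob (map_pmf ((#) s) (path_pmf K n t)) {xs. \<exists>x\<in>set xs. x \<in> D})"
    unfolding hit_within_def path_pmf.simps measure_pmf_bind
    by (subst measure_pmf.measure_bind[where N = "count_space UNIV"])
       (auto simp: measure_pmf_in_subprob_algebra)
  also have "\<dots> = measure_pmf.expectation (K s) (hit_within K D n)"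
    using assms by (simp add: hit_within_def[abs_def] vimage_def)
  finally show ?thesis .
qed

text \<open>Continuity from below: the events of a hit by time \<open>n\<close> increase to the
  event of a hit at some time.\<close>

lemma hit_within_tendsto:
  fixes K :: "'s::countable \<Rightarrow> 's pmf"
  assumes mc: "markov_chain K Pr X"
  shows "(\<lambda>n. hit_within K D n s) \<longlonglongrightarrow> measure (Pr s) {w \<in> space (Pr s). \<exists>n. X n w \<in> D}"
proof -
  interpret prob_space "Pr s" using mc by (simp add: markov_chain_def)
  have X[measurable]: "X i \<in> Pr s \<rightarrow>\<^sub>M count_space UNIV" for i
    using mc by (simp add: markov_chain_def)
  have "hit_within K D n s = measure (Pr s) {w \<in> space (Pr s). \<exists>i\<le>n. X i w \<in> D}" for n
    unfolding hit_within_def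
    by (subst markov_chain_distr[OF mc, symmetric])
       (auto simp: less_Suc_eq_le Bex_def simp del: upt_Suc intro!: arg_cong[where f = "measure (Pr s)"])
  moreover have "(\<lambda>n. measure (Pr s) {w \<in> space (Pr s). \<exists>i\<le>n. X i w \<in> D})
     \<longlonglongrightarrow> measure (Pr s) (\<Union>n. {w \<in> space (Pr s). \<exists>i\<le>n. X i w \<in> D})"
    by (intro finite_Lim_measure_incseq) (auto simp: incseq_def intro: order_trans)
  moreover have "(\<Union>n. {w \<in> space (Pr s). \<exists>i\<le>n. X i w \<in> D}) = {w \<in> space (Pr s). \<exists>n. X n w \<in> D}"
    by auto
  ultimately show ?thesis by simp
qed

text \<open>
  The geometrically decaying \<open>V\<close> takes the place of transience: it makes the contribution of
  the paths that have not yet hit \<open>D\<close> vanish.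
\<close>

lemma subharmonic_le_hitting_probability:
  fixes K :: "'s::countable \<Rightarrow> 's pmf" and h V :: "'s \<Rightarrow> real"
  assumes mc: "markov_chain K Pr X"
    and fin: "\<And>s. finite (set_pmf (K s))"
    and closed: "\<And>s t. s \<in> B \<Longrightarrow> s \<notin> D \<Longrightarrow> t \<in> set_pmf (K s) \<Longrightarrow> t \<in> B"
    and h: "\<And>s. s \<in> B \<Longrightarrow> s \<notin> D \<Longrightarrow> h s \<le> measure_pmf.expectation (K s) h"
    and V: "\<And>s. s \<in> B \<Longrightarrow> s \<notin> D \<Longrightarrow> measure_pmf.expectation (K s) V \<le> \<theta> * V s"
    and V0: "\<And>s. s \<in> B \<Longrightarrow> 0 \<le> V s"
    and \<theta>: "0 \<le> \<theta>" "\<theta> < 1"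
    and hV: "\<And>s. s \<in> B \<Longrightarrow> h s \<le> V s"
    and hD: "\<And>s. s \<in> B \<Longrightarrow> s \<in> D \<Longrightarrow> h s \<le> C"
    and s: "s \<in> B"
  shows "h s \<le> C * measure (Pr s) {w \<in> space (Pr s). \<exists>n. X n w \<in> D}"
proof -
  have int: "integrable (K s) f" for s and f :: "'s \<Rightarrow> real"
    by (rule integrable_measure_pmf_finite[OF fin])
  \<comment> \<open>The one-step inequality, iterated and stopped in \<open>D\<close>: the first
    term accounts for the paths that have hit, the second bounds the contribution of the
    others.\<close>
  have *: "h s \<le> C * hit_within K D n s + \<theta> ^ n * V s" if "s \<in> B" for n s
    using that
  proof (induction n arbitrary: s)
    case 0
    then show ?case
      using hV[of s] hD[of s] V0[of s] by (cases "s \<in> D") (auto simp: hit_within_in hit_within_0)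
  next
    case (Suc n)
    show ?case
    proof (cases "s \<in> D")
      case True
      then show ?thesis
        using hD[of s] V0[of s] Suc.prems \<theta> by (simp add: hit_within_in add_increasing2)
    next
      case False
      have "h s \<le> measure_pmf.expectation (K s) h"
        using Suc.prems False by (rule h)
      \<comment> \<open>\<open>closed\<close> keeps the support of \<open>K s\<close> in
        \<open>B\<close>, where the induction hypothesis applies.\<close>
      also have "\<dots> \<le> measure_pmf.expectation (K s) (\<lambda>t. C * hit_within K D n t + \<theta> ^ n * V t)"
        using Suc.IH closed[OF Suc.prems False]
        by (intro integral_mono_AE int) (auto simp: AE_measure_pmf_iff)
      also have "\<dots> = C * hit_within K D (Suc n) s + \<theta> ^ n * measure_pmf.expectation (K s) V"
        using False by (simp add: hit_within_Suc int)
      also have "\<dots> \<le> C * hit_within K D (Suc n) s + \<theta> ^ n * (\<theta> * V s)"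
        using V[OF Suc.prems False] \<theta> by (intro add_left_mono mult_left_mono) auto
      finally show ?thesis by (simp add: mult_ac)
    qed
  qed
  have "(\<lambda>n. C * hit_within K D n s + \<theta> ^ n * V s) \<longlonglongrightarrow>
      C * measure (Pr s) {w \<in> space (Pr s). \<exists>n. X n w \<in> D} + 0 * V s"
    using \<theta> by (intro tendsto_intros hit_within_tendsto[OF mc] LIMSEQ_realpow_zero)
  then show ?thesis
    using * [OF s] by (intro LIMSEQ_le_const) auto
qed

section \<open>Hitting time of the diagonal and estimates for log-linear functions\<close>

lemma tau_finite_iff:
  "tau x < \<infinity> \<longleftrightarrow> (\<exists>k. fst (fst (x k)) = int (snd (fst (x k))))"
proof -
  have "tau x < \<infinity> \<longleftrightarrow> (\<exists>e\<in>enat ` {k. fst (fst (x k)) = int (snd (fst (x k)))}. e < \<infinity>)"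
    unfolding tau_def by (rule Inf_less_iff)
  then show ?thesis by auto
qed

text \<open>
  In the combination below, the weight \<open>C\<close> makes the strict decay of the \<open>(\<beta>, \<beta>)\<close> term at
  \<open>y(2) = 0\<close> outweigh the boundary defect \<^const>\<open>c_vec\<close> of the \<open>(\<beta>, 1)\<close> term.
\<close>

lemma geometric_supersolution:
  fixes P :: "real^'m^'m" and r :: real
  assumes P: "stochastic P" "irreducible_matrix P" and p: "stationary_distribution P p"
    and rates: "\<And>m. 0 < lam m" "\<And>m. 0 < mu1 m" "\<And>m. 0 < mu2 m"
               "\<And>m. lam m + mu1 m + mu2 m = 1"
    and stability: "(\<Sum>m\<in>UNIV. (lam m - mu1 m) * p $ m * P $ m $ m) < 0"
                   "(\<Sum>m\<in>UNIV. (lam m - mu2 m) * p $ m * P $ m $ m) < 0"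
    and r: "r < 1"
  shows "\<exists>\<beta> \<theta> V. 0 < \<beta> \<and> r \<le> \<beta> \<and> \<beta> < 1 \<and> 0 \<le> \<theta> \<and> \<theta> < 1 \<and>
     (\<forall>y k m. measure_pmf.expectation (step_pmf P lam mu1 mu2 ((y, k), m)) V \<le> \<theta> * V ((y, k), m) \<and>
        \<beta> powi (y - int k) \<le> V ((y, k), m))"
proof -
  obtain \<beta> \<theta>1 \<theta>2 :: real and e1 e2 :: "real^'m" where \<beta>: "0 < \<beta>" "r \<le> \<beta>" "\<beta> < 1" and th: "\<theta>1 < 1" "\<theta>2 < 1"
    and e: "\<And>m. 0 < e1 $ m" "\<And>m. 0 < e2 $ m"
    and A1: "\<And>m. (A_matrix P lam mu1 mu2 \<beta> \<beta> *v e1) $ m \<le> \<theta>1 * e1 $ m"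
    and A2: "\<And>m. (A_matrix P lam mu1 mu2 \<beta> 1 *v e2) $ m \<le> \<theta>2 * e2 $ m"
    using A_matrix_supersolutions[OF P p rates(4) stability r] by blast
  \<comment> \<open>The midpoint \<open>(1 + \<theta>1) / 2\<close> keeps \<open>\<theta>\<close>
    strictly above \<open>\<theta>1\<close>; this gap, scaled by \<open>C\<close>, pays for the
    boundary defect.\<close>
  define \<theta> where "\<theta> = max \<theta>2 (max ((1 + \<theta>1) / 2) 0)"
  have \<theta>: "0 \<le> \<theta>" "\<theta> < 1" "\<theta>2 \<le> \<theta>" "\<theta>1 < \<theta>"
    using th by (auto simp: \<theta>_def less_max_iff_disj)
  \<comment> \<open>A sum of nonnegative ratios bounds each of them, so a single \<open>C\<close>
    serves all modes.\<close>
  define C where "C = (\<Sum>m\<in>UNIV. e2 $ m / e1 $ m) / (\<theta> - \<theta>1)"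
  have C0: "0 \<le> C"
    unfolding C_def using e \<theta>
    by (intro divide_nonneg_nonneg sum_nonneg) (simp_all add: less_imp_le)
  have C: "e2 $ m \<le> C * (\<theta> - \<theta>1) * e1 $ m" for m
  proof -
    have "e2 $ m / e1 $ m \<le> (\<Sum>m\<in>UNIV. e2 $ m / e1 $ m)"
      using e by (intro member_le_sum) (auto intro!: divide_nonneg_nonneg less_imp_le)
    also have "\<dots> = C * (\<theta> - \<theta>1)" using \<theta> by (simp add: C_def)
    finally show ?thesis using e(1)[of m] by (simp add: field_simps)
  qed
  \<comment> \<open>Scaling by \<open>a\<close> makes the \<open>e2\<close> term alone at least
    \<open>\<beta> powi (y - int k)\<close>.\<close>
  define a where "a = (\<Sum>m\<in>UNIV. 1 / e2 $ m)"
  have a0: "0 \<le> a"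
    unfolding a_def using e by (intro sum_nonneg) (simp add: less_imp_le)
  have a: "1 \<le> a * e2 $ m" for m
  proof -
    have "1 / e2 $ m \<le> a"
      unfolding a_def using e by (intro member_le_sum) (auto intro!: less_imp_le)
    then show ?thesis using e(2)[of m] by (simp add: field_simps)
  qed
  define V where "V s = a * (loglin \<beta> 1 e2 s + C * loglin \<beta> \<beta> e1 s)" for s
  have "measure_pmf.expectation (step_pmf P lam mu1 mu2 ((y, k), m)) V \<le> \<theta> * V ((y, k), m)"
    for y k m
  proof -
    define q where "q = \<beta> powi (y - int k)"
    have q: "0 < q" using \<beta> by (simp add: q_def)
    have int: "integrable (step_pmf P lam mu1 mu2 ((y, k), m)) f" for f :: "'m state \<Rightarrow> real"
      using finite_set_step[of P lam mu1 mu2, OF P(1) rates] by (rule integrable_measure_pmf_finite)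
    have c1: "c_vec P mu2 \<beta> \<beta> e1 $ m = 0" using \<beta> by (simp add: c_vec_def)
    have Pm: "0 \<le> P $ m $ m" "P $ m $ m \<le> 1"
    proof -
      show "0 \<le> P $ m $ m" using P(1) by (simp add: stochastic_def)
      have "P $ m $ m \<le> (\<Sum>j\<in>UNIV. P $ m $ j)"
        using P(1) by (intro member_le_sum) (auto simp: stochastic_def)
      then show "P $ m $ m \<le> 1" using P(1) by (simp add: stochastic_def)
    qed
    have "mu2 m \<le> 1" using rates[of m] by simp
    then have "P $ m $ m * mu2 m * (1 - \<beta>) \<le> 1"
      using Pm \<beta> rates(3)[of m] by (intro mult_le_one mult_nonneg_nonneg) auto
    then have "P $ m $ m * mu2 m * (1 - \<beta>) * e2 $ m \<le> e2 $ m"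
      using e(2)[of m] by (simp add: mult_le_cancel_right1)
    then have c2: "c_vec P mu2 \<beta> 1 e2 $ m \<le> e2 $ m" by (simp add: c_vec_def mult_ac)
    have "(A_matrix P lam mu1 mu2 \<beta> 1 *v e2) $ m + (if k = 0 then c_vec P mu2 \<beta> 1 e2 $ m else 0)
        + C * \<beta> ^ k * ((A_matrix P lam mu1 mu2 \<beta> \<beta> *v e1) $ m)
        \<le> \<theta>2 * e2 $ m + (if k = 0 then e2 $ m else 0) + C * \<beta> ^ k * (\<theta>1 * e1 $ m)"
      using A1[of m] A2[of m] c2 C0 \<beta> by (intro add_mono mult_left_mono) auto
    also have "\<dots> \<le> \<theta> * e2 $ m + C * \<beta> ^ k * (\<theta> * e1 $ m)"
    proof -
      have "\<theta>2 * e2 $ m \<le> \<theta> * e2 $ m" using \<theta> e(2)[of m] by (simp add: mult_right_mono)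
      moreover have "(if k = 0 then e2 $ m else 0) + C * \<beta> ^ k * (\<theta>1 * e1 $ m)
          \<le> C * \<beta> ^ k * (\<theta> * e1 $ m)"
      \<comment> \<open>At \<open>k = 0\<close> the factor \<open>\<beta> ^ k\<close> is 1 and the
        gap between the rates covers \<open>e2\<close>; for \<open>k > 0\<close> there is no defect
        and \<open>\<theta>1 < \<theta>\<close> suffices.\<close>
      proof (cases "k = 0")
        case True
        then show ?thesis using C[of m] by (simp add: algebra_simps)
      next
        case False
        then show ?thesis using C0 \<beta> \<theta> e(1)[of m]
          by (auto intro!: mult_left_mono mult_right_mono)
      qed
      ultimately show ?thesis by simp
    qed
    finally have "a * (q * ((A_matrix P lam mu1 mu2 \<beta> 1 *v e2) $ m
          + (if k = 0 then c_vec P mu2 \<beta> 1 e2 $ m else 0)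
          + C * \<beta> ^ k * ((A_matrix P lam mu1 mu2 \<beta> \<beta> *v e1) $ m)))
        \<le> a * (q * (\<theta> * e2 $ m + C * \<beta> ^ k * (\<theta> * e1 $ m)))"
      using a0 q by (intro mult_left_mono) auto
    also have "\<dots> = \<theta> * V ((y, k), m)"
      by (simp add: V_def loglin_def q_def algebra_simps)
    also have "a * (q * ((A_matrix P lam mu1 mu2 \<beta> 1 *v e2) $ m
          + (if k = 0 then c_vec P mu2 \<beta> 1 e2 $ m else 0)
          + C * \<beta> ^ k * ((A_matrix P lam mu1 mu2 \<beta> \<beta> *v e1) $ m)))
        = measure_pmf.expectation (step_pmf P lam mu1 mu2 ((y, k), m)) V"
      unfolding V_def using \<beta>
      by (simp add: int expectation_loglin[OF P(1) rates] c1 q_def algebra_simps)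
    finally show ?thesis .
  qed
  moreover have "\<beta> powi (y - int k) \<le> V ((y, k), m)" for y k m
  proof -
    have "\<beta> powi (y - int k) * 1 \<le> \<beta> powi (y - int k) * (a * e2 $ m)"
      using a \<beta> by (intro mult_left_mono) auto
    also have "\<dots> \<le> V ((y, k), m)"
      using a0 C0 \<beta> e(1)[of m] by (simp add: V_def loglin_def algebra_simps)
    finally show ?thesis by simp
  qed
  ultimately show ?thesis using \<beta> \<theta> by blast
qed

text \<open>On the diagonal the powers of \<open>\<rho>2\<close> disappear from \<open>h2\<close>,
  leaving the first two summands, which tend to \<open>d2\<close> as \<open>k\<close> grows. Only
  finitely many \<open>k\<close> can spoil positivity; on that finite range
  \<open>r ^ k * d1 $ m\<close> is bounded below, so a large \<open>C\<close> compensates.\<close>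

lemma diagonal_lower_bound:
  fixes d1 d2 :: "real^'m" and d :: "nat \<Rightarrow> real^'m"
  assumes "\<And>m. 0 < d1 $ m" "\<And>m. 0 < d2 $ m" and r: "0 < r" "r < 1"
    and \<alpha>: "\<And>j. j \<in> J \<Longrightarrow> 0 < \<alpha> j \<and> \<alpha> j < 1"
  shows "\<exists>c C. 0 < c \<and> 0 \<le> C \<and>
    (\<forall>k m. c \<le> d2 $ m + (\<Sum>j\<in>J. b j * (\<alpha> j ^ k * d j $ m)) + C * (r ^ k * d1 $ m))"
proof -
  have "(\<lambda>k. d2 $ m + (\<Sum>j\<in>J. b j * (\<alpha> j ^ k * d j $ m))) \<longlonglongrightarrow>
      d2 $ m + (\<Sum>j\<in>J. b j * (0 * d j $ m))" for m
    using \<alpha> by (intro tendsto_intros LIMSEQ_realpow_zero) (auto intro: less_imp_le)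
  then have "\<forall>\<^sub>F k in sequentially. d2 $ m / 2 < d2 $ m + (\<Sum>j\<in>J. b j * (\<alpha> j ^ k * d j $ m))" for m
    by (rule order_tendstoD) (use assms(2)[of m] in simp)
  then have "\<forall>\<^sub>F k in sequentially. \<forall>m. d2 $ m / 2 < d2 $ m + (\<Sum>j\<in>J. b j * (\<alpha> j ^ k * d j $ m))"
    by (rule eventually_all_finite)
  then obtain N where
    N: "\<And>k m. N \<le> k \<Longrightarrow> d2 $ m / 2 < d2 $ m + (\<Sum>j\<in>J. b j * (\<alpha> j ^ k * d j $ m))"
    by (auto simp: eventually_sequentially)
  define c where "c = Min (range (($) d2)) / 2"
  have c: "0 < c" "c \<le> d2 $ m / 2" for m
    using assms(2) by (auto simp: c_def)
  define S where "S = (\<Sum>m\<in>UNIV. \<Sum>j\<in>J. \<bar>b j\<bar> * \<bar>d j $ m\<bar>)"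
  have S0: "0 \<le> S" by (auto simp: S_def intro!: sum_nonneg)
  have S: "\<bar>\<Sum>j\<in>J. b j * (\<alpha> j ^ k * d j $ m)\<bar> \<le> S" for k m
  proof -
    have "\<bar>\<Sum>j\<in>J. b j * (\<alpha> j ^ k * d j $ m)\<bar> \<le> (\<Sum>j\<in>J. \<bar>b j * (\<alpha> j ^ k * d j $ m)\<bar>)"
      by (rule sum_abs)
    also have "\<dots> \<le> (\<Sum>j\<in>J. \<bar>b j\<bar> * \<bar>d j $ m\<bar>)"
    proof (rule sum_mono)
      fix j assume "j \<in> J"
      then have "\<bar>\<alpha> j ^ k\<bar> \<le> 1" using \<alpha>[of j] by (simp add: power_abs power_le_one)
      then have "\<bar>\<alpha> j ^ k\<bar> * \<bar>d j $ m\<bar> \<le> \<bar>d j $ m\<bar>" by (rule mult_left_le_one_le[rotated 2]) auto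
      then show "\<bar>b j * (\<alpha> j ^ k * d j $ m)\<bar> \<le> \<bar>b j\<bar> * \<bar>d j $ m\<bar>"
        by (simp add: abs_mult mult_left_mono)
    qed
    also have "\<dots> \<le> S" unfolding S_def
      by (intro member_le_sum[where f = "\<lambda>m. \<Sum>j\<in>J. \<bar>b j\<bar> * \<bar>d j $ m\<bar>"]) (auto intro!: sum_nonneg)
    finally show ?thesis .
  qed
  define \<delta> where "\<delta> = Min (range (($) d1))"
  have \<delta>: "0 < \<delta>" "\<delta> \<le> d1 $ m" for m
    using assms(1) by (auto simp: \<delta>_def)
  \<comment> \<open>For \<open>k < N\<close> the added term is at least
    \<open>C * (r ^ N * \<delta>) = S\<close>, which cancels the sum at its worst.\<close>
  define C where "C = S / (r ^ N * \<delta>)"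
  have C0: "0 \<le> C" using S0 r \<delta> by (simp add: C_def)
  have "c \<le> d2 $ m + (\<Sum>j\<in>J. b j * (\<alpha> j ^ k * d j $ m)) + C * (r ^ k * d1 $ m)" for k m
  proof (cases "N \<le> k")
    case True
    have "0 \<le> C * (r ^ k * d1 $ m)" using C0 r assms(1)[of m] by simp
    then show ?thesis using N[OF True, of m] c(2)[of m] by simp
  next
    case False
    have "S = C * (r ^ N * \<delta>)" using r \<delta> by (simp add: C_def)
    also have "\<dots> \<le> C * (r ^ k * d1 $ m)"
      using False r \<delta>(1) \<delta>(2)[of m] C0 by (intro mult_left_mono mult_mono power_decreasing) auto
    finally show ?thesis using S[where k=k and m=m] c(2)[of m] assms(2)[of m] by (simp add: abs_le_iff)
  qed
  then show ?thesis using c(1) C0 by blast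
qed

text \<open>For \<open>int k \<le> y\<close> the exponent is nonnegative, so the power grows with
  its base. This compares functions with different bases to one power on \<open>B\<close>.\<close>

lemma abs_loglin_le:
  assumes "0 < \<beta>" "\<beta> \<le> \<beta>'" "0 < \<alpha>" "\<alpha> \<le> 1" "int k \<le> y"
  shows "\<bar>loglin \<beta> \<alpha> d ((y, k), m)\<bar> \<le> \<beta>' powi (y - int k) * \<bar>d $ m\<bar>"
proof -
  have "\<bar>\<beta> powi (y - int k) * \<alpha> ^ k\<bar> \<le> \<beta>' powi (y - int k) * 1"
    unfolding abs_mult using assms
    by (intro mult_mono) (auto simp: power_le_one power_int_nonneg_exp power_mono)
  then have "\<bar>\<beta> powi (y - int k) * \<alpha> ^ k\<bar> * \<bar>d $ m\<bar> \<le> \<beta>' powi (y - int k) * 1 * \<bar>d $ m\<bar>"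
    by (rule mult_right_mono) simp
  then show ?thesis by (simp add: loglin_def abs_mult)
qed

section \<open>The two-sided bound on the hitting probability\<close>

theorem proposition7p2:
  fixes P :: "real^('m::finite)^'m"
    and lam mu1 mu2 :: "'m \<Rightarrow> real"
    and p :: "real^'m"
    and \<rho>1 \<rho>2 :: real
    and d1 d2 :: "real^'m"
    and \<alpha> :: "nat \<Rightarrow> real"
    and d2j :: "nat \<Rightarrow> real^'m"
    and b :: "nat \<Rightarrow> real"
    and Pr :: "'m state \<Rightarrow> 'w measure"
    and X :: "nat \<Rightarrow> 'w \<Rightarrow> 'm state"
  defines "K \<equiv> step_pmf P lam mu1 mu2"
    and "A \<equiv> A_matrix P lam mu1 mu2"
    and "\<Lambda> \<equiv> \<lambda>j \<beta> \<alpha>'. eigenvalue_nth j (A_matrix P lam mu1 mu2 \<beta> \<alpha>')"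
    and "h1 \<equiv> loglin \<rho>1 \<rho>1 d1"
    and "h2 \<equiv> \<lambda>s. loglin \<rho>2 1 d2 s + (\<Sum>j = 1..CARD('m). b j * loglin \<rho>2 (\<alpha> j) (d2j j) s)"
  assumes P: "stochastic P" "irreducible_matrix P" "aperiodic_matrix P"
    and p: "stationary_distribution P p"
    and rates: "\<And>m. 0 < lam m" "\<And>m. 0 < mu1 m" "\<And>m. 0 < mu2 m"
               "\<And>m. lam m + mu1 m + mu2 m = 1"
    and chain: "markov_chain K Pr X"
    and stability: "(\<Sum>m\<in>UNIV. (lam m - mu1 m) * p $ m * P $ m $ m) < 0"
                   "(\<Sum>m\<in>UNIV. (lam m - mu2 m) * p $ m * P $ m $ m) < 0"
    and \<rho>1: "0 < \<rho>1" "\<rho>1 < 1" "\<Lambda> 1 \<rho>1 \<rho>1 = 1"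
    and \<rho>2: "0 < \<rho>2" "\<rho>2 < 1" "\<Lambda> 1 \<rho>2 1 = 1"
    and d1: "\<And>m. 0 < d1 $ m" "A \<rho>1 \<rho>1 *v d1 = d1"
    and d2: "\<And>m. 0 < d2 $ m" "A \<rho>2 1 *v d2 = d2"
    and C: "(\<Sum>m\<in>UNIV. (\<rho>2 * mu2 m - mu1 m) * P $ m $ m *
               principal_minor (mat 1 - A \<rho>2 1) m) < 0"
    and \<rho>1_neq_\<rho>2: "\<rho>1 \<noteq> \<rho>2"
    and E: "\<And>\<beta> \<alpha>'. 0 < \<beta> \<Longrightarrow> 0 < \<alpha>' \<Longrightarrow> card (real_eigenvalues (A \<beta> \<alpha>')) = CARD('m)"
    and \<alpha>1: "0 < \<alpha> 1" "\<alpha> 1 < 1" "\<Lambda> 1 \<rho>2 (\<alpha> 1) = 1"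
    and \<alpha>j: "\<And>j. j \<in> {2..CARD('m)} \<Longrightarrow> 0 < \<alpha> j \<and> \<alpha> j < \<alpha> 1 \<and> \<Lambda> j \<rho>2 (\<alpha> j) = 1"
    and d2j: "\<And>j. j \<in> {1..CARD('m)} \<Longrightarrow> d2j j \<noteq> 0 \<and> A \<rho>2 (\<alpha> j) *v d2j j = d2j j"
    and S: "c_vec P mu2 \<rho>2 1 d2 \<in> span ((\<lambda>j. c_vec P mu2 \<rho>2 (\<alpha> j) (d2j j)) ` {1..CARD('m)})"
    and b: "harmonic K h2"
  shows "\<exists>c9 c10 c11 :: real. \<forall>y \<in> B_region. \<forall>m.
           (let prob_hit = measure (Pr (y, m)) {w \<in> space (Pr (y, m)). tau (\<lambda>k. X k w) < \<infinity>};
                h = c11 * (h2 (y, m) + c10 * h1 (y, m))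
            in prob_hit < h \<and> h < c9 * prob_hit)"
proof -
  have \<alpha>01: "0 < \<alpha> j \<and> \<alpha> j < 1" if "j \<in> {1..CARD('m)}" for j
    using that \<alpha>1 \<alpha>j[of j] by (cases "j = 1") auto
  \<comment> \<open>Taken with \<open>r = max \<rho>1 \<rho>2\<close>, so that one base
    \<open>\<beta>\<close> dominates both.\<close>
  obtain \<beta> \<theta> V where \<beta>: "0 < \<beta>" "max \<rho>1 \<rho>2 \<le> \<beta>" "\<beta> < 1" and \<theta>: "0 \<le> \<theta>" "\<theta> < 1"
    and V: "\<And>y k m. measure_pmf.expectation (K ((y, k), m)) V \<le> \<theta> * V ((y, k), m)"
    and \<beta>V: "\<And>y k m. \<beta> powi (y - int k) \<le> V ((y, k), m)"
    using geometric_supersolution[OF P(1,2) p rates stability max_less_iff_conj[THEN iffD2],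
        OF conjI[OF \<rho>1(2) \<rho>2(2)]]
    unfolding K_def by blast
  obtain c C where c: "0 < c" and C: "0 \<le> C" and
    diag: "\<And>k m. c \<le> d2 $ m + (\<Sum>j = 1..CARD('m). b j * (\<alpha> j ^ k * d2j j $ m)) + C * (\<rho>1 ^ k * d1 $ m)"
    using diagonal_lower_bound[of d1 d2 \<rho>1 "{1..CARD('m)}" \<alpha> b d2j] d1(1) d2(1) \<rho>1(1,2) \<alpha>01 by blast
  define D :: "'m state set" where "D = {s. fst (fst s) = int (snd (fst s))}"
  define g where "g s = measure (Pr s) {w \<in> space (Pr s). \<exists>n. X n w \<in> D}" for s
  have g: "measure (Pr s) {w \<in> space (Pr s). tau (\<lambda>k. X k w) < \<infinity>} = g s" for s
    by (simp only: g_def D_def tau_finite_iff mem_Collect_eq)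
  have fin: "finite (set_pmf (K s))" for s
    unfolding K_def by (rule finite_set_step[OF P(1) rates])
  have int: "integrable (K s) f" for s and f :: "'m state \<Rightarrow> real"
    using fin by (rule integrable_measure_pmf_finite)
  \<comment> \<open>No step lowers \<open>y(1) - y(2)\<close> by more than 1, so the walk cannot
    leave \<open>B\<close> without meeting the diagonal.\<close>
  have closed: "t \<in> {s. fst s \<in> B_region}"
    if "s \<in> {s. fst s \<in> B_region}" "s \<notin> D" "t \<in> set_pmf (K s)" for s t
  proof -
    obtain y k m where s: "s = ((y, k), m)" by (metis surj_pair)
    have "t \<in> {(y, k)} \<times> UNIV \<union>
        {attempt (y, k) (-1, 0), attempt (y, k) (1, 1), attempt (y, k) (0, -1)} \<times> {m}"
      using that(3) set_step[of P lam mu1 mu2, OF P(1) rates] unfolding K_def s by blast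
    then show ?thesis
      using that(1,2) by (auto simp: s D_def B_region_def attempt_def nat_add_distrib split: if_splits)
  qed
  \<comment> \<open>With equal parameters the factor \<open>1 - \<beta> / \<alpha>\<close> in
    \<open>c_vec\<close> is 0, so the eigenvector equation alone yields harmonicity.\<close>
  have h1: "measure_pmf.expectation (K s) h1 = h1 s" for s
  proof -
    obtain y k m where s: "s = ((y, k), m)" by (metis surj_pair)
    have "measure_pmf.expectation (K s) h1 = \<rho>1 powi (y - int k) * \<rho>1 ^ k *
        ((A \<rho>1 \<rho>1 *v d1) $ m + (if k = 0 then c_vec P mu2 \<rho>1 \<rho>1 d1 $ m else 0))"
      unfolding h1_def K_def A_def s by (rule expectation_loglin[OF P(1) rates \<rho>1(1) \<rho>1(1)])
    then show ?thesis
      using \<rho>1(1) by (simp add: d1 c_vec_def s h1_def loglin_def)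
  qed
  \<comment> \<open>The coefficient \<open>x\<close> stays free because the lower bound is used both
    at \<open>C\<close> and at \<open>C + 1\<close>.\<close>
  define h where "h x s = h2 s + x * h1 s" for x s
  have harm: "measure_pmf.expectation (K s) (h x) = h x s" for x s
    using b[unfolded harmonic_def, rule_format, of s] h1[of s] by (simp add: h_def[abs_def] int)
  \<comment> \<open>\<open>M x m\<close> bounds the modulus of \<open>h x\<close> in mode
    \<open>m\<close> after division by \<open>\<beta> powi (y - int k)\<close>. It grows with
    \<open>x\<close>, so \<open>N\<close> serves all \<open>0 \<le> x \<le> C + 1\<close> and all
    modes.\<close>
  define M where "M x m = \<bar>d2 $ m\<bar> + (\<Sum>j = 1..CARD('m). \<bar>b j\<bar> * \<bar>d2j j $ m\<bar>) + x * \<bar>d1 $ m\<bar>" for x m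
  define N where "N = (\<Sum>m\<in>UNIV. M (C + 1) m)"
  have M0: "0 \<le> M x m" if "0 \<le> x" for x m
    using that by (auto simp: M_def intro!: add_nonneg_nonneg sum_nonneg)
  have N0: "0 \<le> N" using M0 C by (auto simp: N_def intro!: sum_nonneg)
  have habs: "\<bar>h x ((y, k), m)\<bar> \<le> \<beta> powi (y - int k) * N"
    if "0 \<le> x" "x \<le> C + 1" "int k \<le> y" for x y k m
  proof -
    let ?q = "\<beta> powi (y - int k)"
    have q: "0 \<le> ?q" using \<beta> by simp
    have l2: "\<bar>loglin \<rho>2 1 d2 ((y, k), m)\<bar> \<le> ?q * \<bar>d2 $ m\<bar>"
      using \<rho>2 \<beta> that by (intro abs_loglin_le) auto
    have l1: "\<bar>h1 ((y, k), m)\<bar> \<le> ?q * \<bar>d1 $ m\<bar>"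
      unfolding h1_def using \<rho>1 \<beta> that by (intro abs_loglin_le) auto
    have lj: "\<bar>b j * loglin \<rho>2 (\<alpha> j) (d2j j) ((y, k), m)\<bar> \<le> ?q * (\<bar>b j\<bar> * \<bar>d2j j $ m\<bar>)"
      if j: "j \<in> {1..CARD('m)}" for j
    proof -
      have "\<bar>loglin \<rho>2 (\<alpha> j) (d2j j) ((y, k), m)\<bar> \<le> ?q * \<bar>d2j j $ m\<bar>"
        using \<rho>2 \<beta> \<alpha>01[OF j] \<open>int k \<le> y\<close> by (intro abs_loglin_le) auto
      then have "\<bar>b j\<bar> * \<bar>loglin \<rho>2 (\<alpha> j) (d2j j) ((y, k), m)\<bar> \<le> \<bar>b j\<bar> * (?q * \<bar>d2j j $ m\<bar>)"
        by (rule mult_left_mono) simp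
      then show ?thesis by (simp add: abs_mult mult_ac)
    qed
    have "\<bar>\<Sum>j = 1..CARD('m). b j * loglin \<rho>2 (\<alpha> j) (d2j j) ((y, k), m)\<bar>
        \<le> (\<Sum>j = 1..CARD('m). ?q * (\<bar>b j\<bar> * \<bar>d2j j $ m\<bar>))"
      using lj by (intro order_trans[OF sum_abs] sum_mono) auto
    moreover have "\<bar>x * h1 ((y, k), m)\<bar> \<le> x * (?q * \<bar>d1 $ m\<bar>)"
      using l1 that(1) by (simp add: abs_mult mult_left_mono)
    ultimately have "\<bar>h x ((y, k), m)\<bar> \<le> ?q * M x m"
      using l2 unfolding h_def h2_def M_def
      by (simp add: sum_distrib_left distrib_left mult_ac abs_le_iff)
    also have "M x m \<le> M (C + 1) m"
      using that(2) by (simp add: M_def mult_right_mono)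
    also have "M (C + 1) m \<le> N"
      unfolding N_def using M0 C by (intro member_le_sum) auto
    finally show ?thesis using q by (simp add: mult_left_mono)
  qed
  have hdiag: "c \<le> h x s" if "C \<le> x" "s \<in> D" for x s
  proof -
    obtain k m where s: "s = ((int k, k), m)" using \<open>s \<in> D\<close> unfolding D_def by (cases s) auto
    have "C * (\<rho>1 ^ k * d1 $ m) \<le> x * (\<rho>1 ^ k * d1 $ m)"
      using that(1) \<rho>1(1) d1(1)[of m] by (intro mult_right_mono) auto
    then show ?thesis using diag[of m k] by (simp add: s h_def h2_def h1_def loglin_def)
  qed
  have V0: "0 \<le> V s" for s
  proof -
    obtain y k m where s: "s = ((y, k), m)" by (metis surj_pair)
    have "0 \<le> \<beta> powi (y - int k)" using \<beta> by simp
    then show ?thesis using \<beta>V[of y k m] s by simp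
  qed
  have NV: "measure_pmf.expectation (K s) (\<lambda>s. N * V s) \<le> \<theta> * (N * V s)" for s
  proof -
    obtain y k m where s: "s = ((y, k), m)" by (metis surj_pair)
    show ?thesis using mult_left_mono[OF V[of y k m] N0] by (simp add: s mult_ac)
  qed
  have hV: "\<bar>h x s\<bar> \<le> N * V s" if "0 \<le> x" "x \<le> C + 1" "s \<in> {s. fst s \<in> B_region}" for x s
  proof -
    obtain y k m where s: "s = ((y, k), m)" by (metis surj_pair)
    have "\<bar>h x s\<bar> \<le> \<beta> powi (y - int k) * N"
      unfolding s using that by (intro habs) (auto simp: s B_region_def)
    also have "\<dots> \<le> V s * N" unfolding s by (intro mult_right_mono \<beta>V N0)
    finally show ?thesis by (simp add: mult.commute)
  qed
  have hN: "h x s \<le> N" if "0 \<le> x" "x \<le> C + 1" "s \<in> D" for x s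
  proof -
    obtain k m where s: "s = ((int k, k), m)" using \<open>s \<in> D\<close> unfolding D_def by (cases s) auto
    show ?thesis using habs[OF that(1,2), of k "int k" m] by (simp add: s)
  qed
  \<comment> \<open>The dominating function is \<open>N * V\<close>; on the diagonal the power of
    \<open>\<beta>\<close> is 1, so \<open>N\<close> also bounds \<open>h x\<close> there.\<close>
  have upper: "h x s \<le> N * g s" if "0 \<le> x" "x \<le> C + 1" "s \<in> {s. fst s \<in> B_region}" for x s
    unfolding g_def using that(3)
    by (rule subharmonic_le_hitting_probability[OF chain fin closed _ NV _ \<theta> _ _, rotated -1])
       (use N0 V0 harm hN that(1,2) hV[OF that(1,2)] in \<open>auto simp: abs_le_iff\<close>)
  have lower: "c * g s \<le> h x s" if "C \<le> x" "x \<le> C + 1" "s \<in> {s. fst s \<in> B_region}" for x s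
  proof -
    have x: "0 \<le> x" using that(1) C by simp
    \<comment> \<open>The lower bound is the upper bound for \<open>- h x\<close>, which is at most
      \<open>- c\<close> on the diagonal.\<close>
    have "- h x s \<le> - c * g s"
      unfolding g_def using that(3)
      by (rule subharmonic_le_hitting_probability[OF chain fin closed _ NV _ \<theta> _ _, rotated -1])
         (use N0 V0 harm hdiag that(1,2) hV[OF x that(2)] in \<open>auto simp: abs_le_iff\<close>)
    then show ?thesis by simp
  qed
  have main: "g s < 2 / c * h (C + 1) s \<and> 2 / c * h (C + 1) s < (2 / c * N + 1) * g s"
    if s: "fst s \<in> B_region" for s
  proof -
    \<comment> \<open>The coefficient \<open>C\<close> already makes \<open>h\<close> nonnegative, so \<open>C + 1\<close> makes it positive.\<close>
    have g0: "0 \<le> g s" by (simp add: g_def)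
    have "0 < h1 s"
      using \<rho>1(1) d1(1) by (auto simp: h1_def loglin_def split: prod.split)
    moreover have "0 \<le> h C s"
      using lower[of C s] s c g0 by (auto intro: order_trans[rotated])
    ultimately have pos: "0 < h (C + 1) s" by (simp add: h_def algebra_simps)
    have lo: "c * g s \<le> h (C + 1) s" and up: "h (C + 1) s \<le> N * g s"
      using lower[of "C + 1" s] upper[of "C + 1" s] s C by auto
    \<comment> \<open>Strictness rests on positivity of \<open>h (C + 1) s\<close> and of
      \<open>g s\<close>: the factor 2 leaves room in the first inequality, the summand 1 in the
      second.\<close>
    have "g s > 0" using up pos g0 by (cases "g s = 0") auto
    have "c * g s < 2 * h (C + 1) s" using lo pos by simp
    then have "g s < 2 / c * h (C + 1) s" using c by (simp add: field_simps)
    moreover have "2 / c * h (C + 1) s \<le> 2 / c * (N * g s)"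
      using up c by (intro mult_left_mono) auto
    then have "2 / c * h (C + 1) s < (2 / c * N + 1) * g s"
      using \<open>g s > 0\<close> by (simp add: algebra_simps)
    ultimately show ?thesis ..
  qed
  show ?thesis
  proof (intro exI ballI allI)
    \<comment> \<open>The constants are \<open>c9 = 2 / c * N + 1\<close>,
      \<open>c10 = C + 1\<close> and \<open>c11 = 2 / c\<close>.\<close>
    fix y m assume "y \<in> B_region"
    then show "let prob_hit = measure (Pr (y, m)) {w \<in> space (Pr (y, m)). tau (\<lambda>k. X k w) < \<infinity>};
                h = 2 / c * (h2 (y, m) + (C + 1) * h1 (y, m))
            in prob_hit < h \<and> h < (2 / c * N + 1) * prob_hit"
      using main[of "(y, m)"] unfolding Let_def g h_def by simp
  qed
qed

end
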